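(* Let $(Y,*_Y)$ be a $*$-admissible $*$-first-countable Choquet pointed space. For any topological space $X$ the following conditions are equivalent: (1) $C_k'(X,Y)$ is Baire; (2) $C_k'(X,Y)$ is not meager; (3) $X$ has DMOP (the discrete moving off property).
   Context: A point $x\in X$ is isolated if $\{x\}$ is clopen in $X$; $\dot X$ is the set of isolated points of $X$ and $X'=X\setminus\dot X$. A pointed space is a topological space $Y$ with a distinguished point $*_Y$; it is $*$-first-countable if $Y$ is first-countable at $*_Y$, and $*$-admissible if $*_Y$ has a neighborhood which is not dense in $Y$. $C_k(X,Y)$ is the space of continuous functions $X\to Y$ with the compact-open topology (subbase: $\{f:f(K)\subset U\}$, $K\subset X$ compact, $U\subset Y$ open), and $C_k'(X,Y)=\{f\in C_k(X,Y):f(X')\subset\{*_Y\}\}$ with the subspace topology. Choquet: in the game $\mathsf{G_{EN}}(Z)$ on a space $Z$, player $\mathsf E$ starts with a non-empty open $U_1$, player $\mathsf N$ answers with a non-empty open $V_1\subset U_1$, and at the $n$-th inning $\mathsf E$ chooses a non-empty open $U_n\subset V_{n-1}$ and $\mathsf N$ a non-empty open $V_n\subset U_n$; $\mathsf N$ wins iff $\bigcap_nU_n\neq\emptyset$. $Z$ is Choquet if $\mathsf N$ has a winning strategy. A space is Baire if countable intersections of open dense sets are dense; meager if it is a countable union of its nowhere dense subsets. DMOP: a family $\mathcal F$ of subsets of $X$ is moving off if for every compact $K\subset X$ there is a non-empty $F\in\mathcal F$ with $K\cap F=\emptyset$; a family is discrete in $X$ if each point of $X$ has a neighborhood meeting at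 most one member of the family. $X$ has DMOP if every moving off family of finite subsets of $\dot X$ contains an infinite subfamily that is discrete in $X$. *)

theory Defs
  imports "HOL-Analysis.Analysis"
begin

section \<open>Isolated points and the discrete moving off property\<close>

text \<open>As in the source, an isolated point is one whose singleton is clopen, not merely open;
  the two notions differ for spaces that are not T1.\<close>

definition isolated_points :: "'a topology \<Rightarrow> 'a set" where
  "isolated_points X = {x \<in> topspace X. openin X {x} \<and> closedin X {x}}"

definition nonisolated_points :: "'a topology \<Rightarrow> 'a set" where
  "nonisolated_points X = topspace X - isolated_points X"

definition moving_off :: "'a topology \<Rightarrow> 'a set set \<Rightarrow> bool" where
  "moving_off X \<F> \<longleftrightarrow> (\<forall>K. compactin X K \<longrightarrow> (\<exists>F\<in>\<F>. F \<noteq> {} \<and> K \<inter> F = {}))"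

definition discrete_family_in :: "'a topology \<Rightarrow> 'a set set \<Rightarrow> bool" where
  "discrete_family_in X \<D> \<longleftrightarrow>
     (\<forall>x\<in>topspace X. \<exists>U. openin X U \<and> x \<in> U \<and>
        (\<forall>A\<in>\<D>. \<forall>B\<in>\<D>. A \<inter> U \<noteq> {} \<and> B \<inter> U \<noteq> {} \<longrightarrow> A = B))"

definition DMOP :: "'a topology \<Rightarrow> bool" where
  "DMOP X \<longleftrightarrow>
     (\<forall>\<F>. (\<forall>F\<in>\<F>. finite F \<and> F \<subseteq> isolated_points X) \<and> moving_off X \<F> \<longrightarrow>
        (\<exists>\<D>\<subseteq>\<F>. infinite \<D> \<and> discrete_family_in X \<D>))"


section \<open>Baire and meager spaces\<close>

definition dense_in :: "'a topology \<Rightarrow> 'a set \<Rightarrow> bool" where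
  "dense_in Z S \<longleftrightarrow> S \<subseteq> topspace Z \<and> Z closure_of S = topspace Z"

definition nowhere_dense_in :: "'a topology \<Rightarrow> 'a set \<Rightarrow> bool" where
  "nowhere_dense_in Z S \<longleftrightarrow> S \<subseteq> topspace Z \<and> Z interior_of (Z closure_of S) = {}"

text \<open>Intersecting with the carrier only matters for the empty family, whose
  intersection would otherwise be the whole type.\<close>

definition Baire_space :: "'a topology \<Rightarrow> bool" where
  "Baire_space Z \<longleftrightarrow>
     (\<forall>\<G>. countable \<G> \<and> (\<forall>G\<in>\<G>. openin Z G \<and> dense_in Z G) \<longrightarrow>
        dense_in Z (topspace Z \<inter> \<Inter>\<G>))"

definition meager_space :: "'a topology \<Rightarrow> bool" where
  "meager_space Z \<longleftrightarrow>
     (\<exists>\<N>. countable \<N> \<and> (\<forall>S\<in>\<N>. nowhere_dense_in Z S) \<and> topspace Z = \<Union>\<N>)"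


section \<open>The Choquet game\<close>

text \<open>A strategy \<open>\<sigma>\<close> of player N maps the list of all moves made so far by player E to N's
  answer. (N's own earlier answers are determined by \<open>\<sigma>\<close>, so this records the full history.)
  The predicate below says that \<open>us\<close> is a legal finite sequence of moves of E against \<open>\<sigma>\<close>,
  where \<open>\<sigma> (take i us)\<close> is the answer of N preceding the move \<open>us ! i\<close> (for \<open>i > 0\<close>).\<close>

definition E_moves_legal :: "'a topology \<Rightarrow> ('a set list \<Rightarrow> 'a set) \<Rightarrow> 'a set list \<Rightarrow> bool" where
  "E_moves_legal Z \<sigma> us \<longleftrightarrow>
     (\<forall>i<length us. openin Z (us ! i) \<and> us ! i \<noteq> {} \<and> (0 < i \<longrightarrow> us ! i \<subseteq> \<sigma> (take i us)))"

text \<open>Legality of N's answers is required along finite plays: requiring it only along infinite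
  plays would allow N to win by giving an answer after which E cannot move.\<close>

definition winning_strategy_N :: "'a topology \<Rightarrow> ('a set list \<Rightarrow> 'a set) \<Rightarrow> bool" where
  "winning_strategy_N Z \<sigma> \<longleftrightarrow>
     (\<forall>us. us \<noteq> [] \<and> E_moves_legal Z \<sigma> us \<longrightarrow>
        openin Z (\<sigma> us) \<and> \<sigma> us \<noteq> {} \<and> \<sigma> us \<subseteq> last us) \<and>
     (\<forall>U :: nat \<Rightarrow> 'a set. (\<forall>n. E_moves_legal Z \<sigma> (map U [0..<n])) \<longrightarrow> (\<Inter>n. U n) \<noteq> {})"

definition Choquet_space :: "'a topology \<Rightarrow> bool" where
  "Choquet_space Z \<longleftrightarrow> (\<exists>\<sigma>. winning_strategy_N Z \<sigma>)"


section \<open>Pointed spaces\<close>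

definition first_countable_at :: "'a topology \<Rightarrow> 'a \<Rightarrow> bool" where
  "first_countable_at Y y \<longleftrightarrow>
     (\<exists>\<B>. countable \<B> \<and> (\<forall>V\<in>\<B>. openin Y V) \<and>
        (\<forall>U. openin Y U \<and> y \<in> U \<longrightarrow> (\<exists>V\<in>\<B>. y \<in> V \<and> V \<subseteq> U)))"

definition admissible_at :: "'a topology \<Rightarrow> 'a \<Rightarrow> bool" where
  "admissible_at Y y \<longleftrightarrow>
     (\<exists>N\<subseteq>topspace Y. (\<exists>U. openin Y U \<and> y \<in> U \<and> U \<subseteq> N) \<and> \<not> dense_in Y N)"


section \<open>Function spaces\<close>

text \<open>Continuous functions between the carriers are represented by their extensional
  representatives (value \<open>undefined\<close> off the carrier of \<open>X\<close>), so that each function is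
  represented exactly once.\<close>

definition cont_maps :: "'a topology \<Rightarrow> 'b topology \<Rightarrow> ('a \<Rightarrow> 'b) set" where
  "cont_maps X Y = {f \<in> extensional (topspace X). continuous_map X Y f}"

definition Ck :: "'a topology \<Rightarrow> 'b topology \<Rightarrow> ('a \<Rightarrow> 'b) topology" where
  "Ck X Y = topology_generated_by
     {{f \<in> cont_maps X Y. f ` K \<subseteq> U} | K U. compactin X K \<and> openin Y U}"

definition Ck' :: "'a topology \<Rightarrow> 'b topology \<Rightarrow> 'b \<Rightarrow> ('a \<Rightarrow> 'b) topology" where
  "Ck' X Y y = subtopology (Ck X Y) {f \<in> cont_maps X Y. f ` nonisolated_points X \<subseteq> {y}}"

lemma topspace_Ck [simp]: "topspace (Ck X Y) = cont_maps X Y"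
proof -
  have "cont_maps X Y \<in> {{f \<in> cont_maps X Y. f ` K \<subseteq> U} | K U. compactin X K \<and> openin Y U}"
    by (auto intro!: exI[of _ "{}"])
  then show ?thesis
    unfolding Ck_def topology_generated_by_topspace by blast
qed

lemma topspace_Ck' [simp]:
  "topspace (Ck' X Y y) = {f \<in> cont_maps X Y. f ` nonisolated_points X \<subseteq> {y}}"
  by (auto simp: Ck'_def)

end

theory Submission
  imports Defs
begin

text \<open>If \<open>C\<^sub>k'(X,Y)\<close> is not meager and \<open>\<F>\<close> is moving off, a generic map sends \<open>n\<close> pairwise
  disjoint members of \<open>\<F>\<close> into an open set \<open>W\<close> away from the base point, for every \<open>n\<close>. It then
  does so for infinitely many disjoint members, and continuity at the non-isolated points, which
  go to the base point, makes them discrete.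

  Conversely, given dense open sets, shrink basic open sets of \<open>C\<^sub>k'(X,Y)\<close> step by step, running
  one Choquet game on \<open>Y\<close> at each of the finitely many isolated points constrained so far. The
  limit map is continuous as soon as the points constrained at each step outside the compact set
  controlled at that step all lie in one closed set \<open>A\<close> of isolated points. To achieve this, use
  DMOP once at every position to reduce the choice of the next compact set to countably many
  ones; only countably many positions are then reachable, and a second use of DMOP yields one
  \<open>A\<close> that contains, at every reachable position, the new points of some next step. Following
  these steps gives the required play.\<close>

section \<open>Moving off families of isolated points\<close>

lemma openin_subset_isolated_points:
  assumes "A \<subseteq> isolated_points X"
  shows "openin X A"
proof -
  have "openin X (\<Union>x\<in>A. {x})"
    using assms by (intro openin_Union) (auto simp: isolated_points_def)
  then show ?thesis by simp
qed

lemma closedin_finite_isolated_points: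
  assumes "finite A" "A \<subseteq> isolated_points X"
  shows "closedin X A"
proof -
  have "closedin X (\<Union>((\<lambda>x. {x}) ` A))"
    using assms by (intro closedin_Union) (auto simp: isolated_points_def)
  then show ?thesis by simp
qed

text \<open>Every point of \<open>A - B\<close> is open, so removing it from \<open>A\<close> leaves
  a closed set. Continuity of a limit map thus reduces to enclosing the points with values far from
  the base point in one such \<open>A\<close>.\<close>

lemma closedin_subset_isolated_points:
  assumes "closedin X A" "A \<subseteq> isolated_points X" "B \<subseteq> A"
  shows "closedin X B"
proof -
  have "topspace X - B = (topspace X - A) \<union> (A - B)"
    using assms closedin_subset by blast
  moreover have "openin X ((topspace X - A) \<union> (A - B))"
    using assms by (intro openin_Un openin_subset_isolated_points[of "A - B"]) auto
  ultimately show ?thesis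
    using assms closedin_subset by (metis closedin_def dual_order.trans)
qed

lemma isolated_points_subset_topspace: "isolated_points X \<subseteq> topspace X"
  by (auto simp: isolated_points_def)

lemma finite_compactin_isolated_points:
  assumes "compactin X K" "K \<subseteq> isolated_points X"
  shows "finite K"
proof -
  obtain \<V> where "finite \<V>" "\<V> \<subseteq> (\<lambda>x. {x}) ` K" "K \<subseteq> \<Union>\<V>"
    using compactinD[OF assms(1), of "(\<lambda>x. {x}) ` K"] assms(2)
    by (auto simp: isolated_points_def)
  then show ?thesis
    by (auto intro!: finite_subset[of K "\<Union>\<V>"])
qed

lemma finite_if_all_equal:
  assumes "\<And>x y. x \<in> S \<Longrightarrow> y \<in> S \<Longrightarrow> x = y"
  shows "finite S"
proof (cases "S = {}")
  case False
  then obtain a where "a \<in> S" by blast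
  then have "S \<subseteq> {a}" using assms by blast
  then show ?thesis using finite_subset by blast
qed auto

lemma discrete_family_in_eqI:
  assumes "discrete_family_in X \<D>" "A \<in> \<D>" "B \<in> \<D>" "x \<in> A" "x \<in> B" "x \<in> topspace X"
  shows "A = B"
proof -
  obtain U where "x \<in> U" "\<forall>A\<in>\<D>. \<forall>B\<in>\<D>. A \<inter> U \<noteq> {} \<and> B \<inter> U \<noteq> {} \<longrightarrow> A = B"
    using assms(1)[unfolded discrete_family_in_def, rule_format, OF assms(6)] by (elim exE conjE)
  then show ?thesis using assms(2-5) by blast
qed

text \<open>Finitely many open sets, each meeting at most one member, cover
  \<open>K\<close>.\<close>

lemma finite_discrete_family_in_meeting_compactin:
  assumes "discrete_family_in X \<D>" "compactin X K"
  shows "finite {A \<in> \<D>. A \<inter> K \<noteq> {}}"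
proof -
  obtain U where U: "\<And>x. x \<in> topspace X \<Longrightarrow> openin X (U x) \<and> x \<in> U x \<and>
      (\<forall>A\<in>\<D>. \<forall>B\<in>\<D>. A \<inter> U x \<noteq> {} \<and> B \<inter> U x \<noteq> {} \<longrightarrow> A = B)"
    using assms(1) unfolding discrete_family_in_def by metis
  have Ks: "K \<subseteq> topspace X"
    using assms(2) compactin_subset_topspace by blast
  obtain \<V> where V: "finite \<V>" "\<V> \<subseteq> U ` K" "K \<subseteq> \<Union>\<V>"
    using compactinD[OF assms(2), of "U ` K"] U Ks by blast
  have "finite {A \<in> \<D>. A \<inter> V \<noteq> {}}" if "V \<in> \<V>" for V
  proof -
    have "V \<in> U ` K" using that V(2) by blast
    then obtain x where "x \<in> K" "V = U x" by blast
    then show ?thesis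
      using U[of x] Ks by (intro finite_if_all_equal) blast
  qed
  then have "finite (\<Union>V\<in>\<V>. {A \<in> \<D>. A \<inter> V \<noteq> {}})"
    using V by blast
  moreover have "{A \<in> \<D>. A \<inter> K \<noteq> {}} \<subseteq> (\<Union>V\<in>\<V>. {A \<in> \<D>. A \<inter> V \<noteq> {}})"
  proof
    fix A assume A: "A \<in> {A \<in> \<D>. A \<inter> K \<noteq> {}}"
    then obtain x where x: "x \<in> A" "x \<in> K" by auto
    then obtain V where "V \<in> \<V>" "x \<in> V" using V(3) by auto
    then show "A \<in> (\<Union>V\<in>\<V>. {A \<in> \<D>. A \<inter> V \<noteq> {}})" using A x by auto
  qed
  ultimately show ?thesis by (rule rev_finite_subset)
qed

lemma closedin_Union_discrete_family_in:
  assumes "discrete_family_in X \<D>" "\<And>A. A \<in> \<D> \<Longrightarrow> closedin X A"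
  shows "closedin X (\<Union>\<D>)"
proof (rule closedin_locally_finite_Union)
  show "locally_finite_in X \<D>"
    unfolding locally_finite_in_def
  proof (intro conjI ballI)
    show "\<Union>\<D> \<subseteq> topspace X"
      using assms(2) closedin_subset by blast
    fix x assume x: "x \<in> topspace X"
    obtain U where U: "openin X U" "x \<in> U"
        "\<forall>A\<in>\<D>. \<forall>B\<in>\<D>. A \<inter> U \<noteq> {} \<and> B \<inter> U \<noteq> {} \<longrightarrow> A = B"
      using assms(1)[unfolded discrete_family_in_def, rule_format, OF x] by (elim exE conjE)
    then have "finite {A \<in> \<D>. A \<inter> U \<noteq> {}}"
      by (intro finite_if_all_equal) blast
    then show "\<exists>V. openin X V \<and> x \<in> V \<and> finite {U \<in> \<D>. U \<inter> V \<noteq> {}}"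
      using U by blast
  qed
qed (use assms(2) in blast)

section \<open>Consequences of DMOP\<close>

text \<open>When no compact set contains all isolated points, their singletons are moving off; an
  infinite discrete subfamily has a closed infinite union.\<close>

lemma DMOP_closed_infinite_subset:
  assumes "DMOP X" "\<And>K. compactin X K \<Longrightarrow> \<not> isolated_points X \<subseteq> K"
  obtains E where "closedin X E" "E \<subseteq> isolated_points X" "infinite E"
proof -
  have "moving_off X ((\<lambda>x. {x}) ` isolated_points X)"
    unfolding moving_off_def using assms(2) by blast
  then obtain \<D> where D: "\<D> \<subseteq> (\<lambda>x. {x}) ` isolated_points X" "infinite \<D>" "discrete_family_in X \<D>"
    using assms(1) unfolding DMOP_def by (elim allE[of _ "(\<lambda>x. {x}) ` isolated_points X"]) auto
  have "closedin X (\<Union>\<D>)"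
    using D by (intro closedin_Union_discrete_family_in closedin_finite_isolated_points) auto
  moreover have "infinite (\<Union>\<D>)"
    using D(2) finite_UnionD by blast
  moreover have "\<Union>\<D> \<subseteq> isolated_points X" using D(1) by auto
  ultimately show ?thesis by (intro that)
qed

text \<open>Each family is hit because the auxiliary moving off family consists of unions of members
  of the first \<open>m + 1\<close> families; the marker \<open>d m\<close> forces \<open>m\<close> to be unbounded along any
  infinite discrete subfamily.\<close>

lemma DMOP_closed_selection:
  fixes \<H> :: "nat \<Rightarrow> 'a set set"
  assumes "DMOP X"
    and fin: "\<And>n F. F \<in> \<H> n \<Longrightarrow> finite F \<and> F \<subseteq> isolated_points X"
    and avoid: "\<And>n K. compactin X K \<Longrightarrow> \<exists>F\<in>\<H> n. F \<inter> K = {}"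
  shows "\<exists>A. closedin X A \<and> A \<subseteq> isolated_points X \<and> (\<forall>n. \<exists>F\<in>\<H> n. F \<subseteq> A)"
proof (cases "\<exists>K. compactin X K \<and> isolated_points X \<subseteq> K")
  case True
  then obtain K where K: "compactin X K" "isolated_points X \<subseteq> K" by blast
  \<comment> \<open>A member of \<open>\<H> n\<close> disjoint from a compact set containing all
    isolated points is empty.\<close>
  have "\<exists>F\<in>\<H> n. F \<subseteq> {}" for n
    using avoid[OF K(1), of n] fin[of _ n] K(2) by blast
  then show ?thesis by (intro exI[of _ "{}"]) auto
next
  case False
  then obtain E where E: "closedin X E" "E \<subseteq> isolated_points X" "infinite E"
    using DMOP_closed_infinite_subset[OF assms(1)] by metis
  then obtain d :: "nat \<Rightarrow> 'a" where d: "inj d" "range d \<subseteq> E"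
    using infinite_countable_subset[OF E(3)] by blast
  define \<F> where "\<F> = {insert (d m) (\<Union>n\<le>m. P n) | m P. \<forall>n\<le>m. P n \<in> \<H> n}"
  have finF: "finite F \<and> F \<subseteq> isolated_points X" if F: "F \<in> \<F>" for F
  proof -
    obtain m P where P: "F = insert (d m) (\<Union>n\<le>m. P n)" "\<forall>n\<le>m. P n \<in> \<H> n"
      using F unfolding \<F>_def by (elim CollectE exE conjE)
    have "d m \<in> isolated_points X" using d(2) E(2) by blast
    moreover have "finite (P n) \<and> P n \<subseteq> isolated_points X" if "n \<le> m" for n
      using that P(2) fin by blast
    ultimately show ?thesis unfolding P(1) by (simp add: UN_subset_iff)
  qed
  have "moving_off X \<F>"
    unfolding moving_off_def
  proof (intro allI impI)
    fix K assume K: "compactin X K"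
    \<comment> \<open>As \<open>E\<close> is closed, \<open>K \<inter> E\<close> is compact, hence
      finite, and cannot contain every marker.\<close>
    have "compactin X (K \<inter> E)" using K E(1) by (rule compact_Int_closedin)
    then have "finite (K \<inter> E)"
      by (rule finite_compactin_isolated_points) (use E in auto)
    then have "\<not> range d \<subseteq> K \<inter> E"
      using d(1) by (meson finite_imageD finite_subset infinite_UNIV_nat)
    then obtain m where m: "d m \<notin> K" using d by auto
    obtain P where P: "\<And>n. P n \<in> \<H> n" "\<And>n. P n \<inter> K = {}"
      using avoid[OF K] by metis
    have "insert (d m) (\<Union>n\<le>m. P n) \<in> \<F>" unfolding \<F>_def using P(1) by (intro CollectI exI[of _ m] exI[of _ P]) simp
    then show "\<exists>F\<in>\<F>. F \<noteq> {} \<and> K \<inter> F = {}"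
      using m P(2) by (intro bexI[of _ "insert (d m) (\<Union>n\<le>m. P n)"]) auto
  qed
  then obtain \<D> where D: "\<D> \<subseteq> \<F>" "infinite \<D>" "discrete_family_in X \<D>"
    using assms(1) finF unfolding DMOP_def by (elim allE[of _ \<F>]) blast
  have 1: "closedin X (\<Union>\<D>)"
    using D(1) finF by (intro closedin_Union_discrete_family_in[OF D(3)] closedin_finite_isolated_points) auto
  have 2: "\<Union>\<D> \<subseteq> isolated_points X" using D finF by blast
  have "\<exists>F\<in>\<H> n. F \<subseteq> \<Union>\<D>" for n
  proof (rule ccontr)
    assume none: "\<not> ?thesis"
    \<comment> \<open>With \<open>n \<le> m\<close> the member would contain some \<open>P n\<close>
      from \<open>\<H> n\<close>.\<close>
    have "\<exists>m<n. d m \<in> A" if A: "A \<in> \<D>" for A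
    proof -
      obtain m P where P: "A = insert (d m) (\<Union>n\<le>m. P n)" "\<forall>n\<le>m. P n \<in> \<H> n"
        using subsetD[OF D(1) A] unfolding \<F>_def by (elim CollectE exE conjE)
      have "\<not> n \<le> m" using none P A by blast
      then show ?thesis using P(1) by (intro exI[of _ m]) auto
    qed
    then have "\<forall>A\<in>\<D>. \<exists>m. m < n \<and> d m \<in> A" by blast
    from bchoice[OF this] obtain m where m: "\<forall>A\<in>\<D>. m A < n \<and> d (m A) \<in> A" ..
    \<comment> \<open>Members of a discrete family sharing a marker coincide, so \<open>\<D>\<close>
      injects into the indices below \<open>n\<close>.\<close>
    have "inj_on m \<D>"
    proof (rule inj_onI)
      fix A B assume "A \<in> \<D>" "B \<in> \<D>" "m A = m B"
      then show "A = B"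
        using discrete_family_in_eqI[OF D(3), of A B "d (m A)"] m 2
          isolated_points_subset_topspace by (metis Union_iff subsetD)
    qed
    moreover have "m ` \<D> \<subseteq> {..<n}" using m by auto
    ultimately show False
      using D(2) by (meson finite_imageD finite_lessThan finite_subset)
  qed
  with 1 2 show ?thesis by (intro exI[of _ "\<Union>\<D>"]) simp
qed

text \<open>A compact set meets only finitely many members of a discrete family. Hence countably
  many \<open>K\<close> whose images under \<open>\<Phi>\<close> form an infinite discrete family
  serve every compact \<open>C\<close>.\<close>

lemma DMOP_countable_avoiding:
  assumes "DMOP X"
    and \<Phi>: "\<And>K. compactin X K \<Longrightarrow> finite (\<Phi> K) \<and> \<Phi> K \<subseteq> isolated_points X \<and> \<Phi> K \<inter> K = {}"
  shows "\<exists>\<C>. countable \<C> \<and> (\<forall>K\<in>\<C>. compactin X K) \<and>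
    (\<forall>C. compactin X C \<longrightarrow> (\<exists>K\<in>\<C>. \<Phi> K \<inter> C = {}))"
proof (cases "\<exists>K. compactin X K \<and> \<Phi> K = {}")
  case True
  \<comment> \<open>Moving off needs non-empty members, so an empty value is treated apart; it
    avoids every \<open>C\<close>.\<close>
  then obtain K where K: "compactin X K" "\<Phi> K = {}" by (elim exE conjE)
  then show ?thesis by (intro exI[of _ "{K}"]) auto
next
  case False
  have "moving_off X (\<Phi> ` Collect (compactin X))"
    unfolding moving_off_def
  proof (intro allI impI)
    fix K assume "compactin X K"
    then show "\<exists>F\<in>\<Phi> ` Collect (compactin X). F \<noteq> {} \<and> K \<inter> F = {}"
      using \<Phi>[of K] False by (intro bexI[of _ "\<Phi> K"]) auto
  qed
  then obtain \<D> where D: "\<D> \<subseteq> \<Phi> ` Collect (compactin X)" "infinite \<D>" "discrete_family_in X \<D>"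
    using assms(1) \<Phi> unfolding DMOP_def by (elim allE[of _ "\<Phi> ` Collect (compactin X)"]) auto
  obtain \<D>' where D': "\<D>' \<subseteq> \<D>" "countable \<D>'" "infinite \<D>'"
    using infinite_countable_subset'[OF D(2)] by blast
  obtain \<C> where C: "\<C> \<subseteq> Collect (compactin X)" "countable \<C>" "\<D>' = \<Phi> ` \<C>"
    using countable_subset_image[of \<D>' \<Phi> "Collect (compactin X)"] D' D(1) by (metis dual_order.trans)
  have "\<exists>K\<in>\<C>. \<Phi> K \<inter> C = {}" if C': "compactin X C" for C
  proof (rule ccontr)
    assume "\<not> ?thesis"
    then have "\<D>' \<subseteq> {A \<in> \<D>. A \<inter> C \<noteq> {}}" using C D' by auto
    then show False
      using finite_discrete_family_in_meeting_compactin[OF D(3) C'] D'(3) finite_subset by blast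
  qed
  then show ?thesis using C by (intro exI[of _ \<C>]) auto
qed

text \<open>The set \<open>A\<close> must be fixed before the play is known. Allowing only countably
  many moves at each position leaves countably many reachable positions; \<open>A\<close> is chosen
  for all of them at once, and the play then follows moves with \<open>L\<close> inside
  \<open>A\<close>.\<close>

lemma DMOP_game:
  fixes step :: "'s \<Rightarrow> 'a set \<Rightarrow> 's" and L :: "'s \<Rightarrow> 'a set \<Rightarrow> 'a set"
  assumes "DMOP X" and "valid s0"
    and step: "\<And>s K. valid s \<Longrightarrow> compactin X K \<Longrightarrow> valid (step s K)"
    and L: "\<And>s K. valid s \<Longrightarrow> compactin X K \<Longrightarrow>
      finite (L s K) \<and> L s K \<subseteq> isolated_points X \<and> L s K \<inter> K = {}"
  obtains s K A where "s 0 = s0" "\<And>n. s (Suc n) = step (s n) (K n)"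
    "\<And>n. valid (s n)" "\<And>n. compactin X (K n)"
    "closedin X A" "A \<subseteq> isolated_points X" "\<And>n. L (s n) (K n) \<subseteq> A"
proof -
  define good where "good s \<C> \<longleftrightarrow> countable \<C> \<and> (\<forall>K\<in>\<C>. compactin X K) \<and>
      (\<forall>C. compactin X C \<longrightarrow> (\<exists>K\<in>\<C>. L s K \<inter> C = {}))" for s \<C>
  have "\<exists>\<C>. good s \<C>" if s: "valid s" for s
    using DMOP_countable_avoiding[OF assms(1) L[OF s]] unfolding good_def .
  then obtain \<C> where "\<And>s. valid s \<Longrightarrow> good s (\<C> s)" by metis
  then have \<C>: "\<And>s. valid s \<Longrightarrow> countable (\<C> s)"
      "\<And>s K. valid s \<Longrightarrow> K \<in> \<C> s \<Longrightarrow> compactin X K"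
      "\<And>s C. valid s \<Longrightarrow> compactin X C \<Longrightarrow> \<exists>K\<in>\<C> s. L s K \<inter> C = {}"
    unfolding good_def by blast+
  \<comment> \<open>\<open>R n\<close> holds the positions reachable in \<open>n\<close> moves drawn
    from \<open>\<C>\<close>.\<close>
  define R where "R = rec_nat {s0} (\<lambda>_ S. \<Union>s\<in>S. step s ` \<C> s)"
  have R0: "R 0 = {s0}" and RS: "R (Suc n) = (\<Union>s\<in>R n. step s ` \<C> s)" for n
    by (simp_all add: R_def)
  have R: "countable (R n) \<and> (\<forall>s\<in>R n. valid s)" for n
  proof (induction n)
    case 0 then show ?case using assms(2) by (simp add: R0)
  next
    case (Suc n)
    then show ?case unfolding RS using \<C>(1,2) step by (auto intro!: countable_UN)
  qed
  define T where "T = (\<Union>n. R n)"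
  have T: "countable T" "s0 \<in> T" "\<And>s. s \<in> T \<Longrightarrow> valid s"
      "\<And>s K. s \<in> T \<Longrightarrow> K \<in> \<C> s \<Longrightarrow> step s K \<in> T"
  proof -
    show "countable T" "\<And>s. s \<in> T \<Longrightarrow> valid s" using R by (auto simp: T_def)
    show "s0 \<in> T" unfolding T_def using R0 by blast
    fix s K assume "s \<in> T" "K \<in> \<C> s"
    then show "step s K \<in> T" unfolding T_def using RS by blast
  qed
  define e where "e = from_nat_into T"
  have e: "range e = T" unfolding e_def using T by (intro range_from_nat_into) auto
  define \<H> where "\<H> n = L (e n) ` \<C> (e n)" for n
  have eT: "e n \<in> T" for n using e by blast
  have "\<exists>A. closedin X A \<and> A \<subseteq> isolated_points X \<and> (\<forall>n. \<exists>F\<in>\<H> n. F \<subseteq> A)"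
  proof (rule DMOP_closed_selection[OF assms(1), of \<H>])
    show "finite F \<and> F \<subseteq> isolated_points X" if "F \<in> \<H> n" for n F
      using that L T(3)[OF eT[of n]] \<C>(2) unfolding \<H>_def by blast
    show "\<exists>F\<in>\<H> n. F \<inter> K = {}" if "compactin X K" for n K
      using \<C>(3)[OF T(3)[OF eT[of n]] that] by (simp add: \<H>_def)
  qed
  then obtain A where A: "closedin X A" "A \<subseteq> isolated_points X" "\<forall>n. \<exists>F\<in>\<H> n. F \<subseteq> A"
    by (elim exE conjE)
  have "\<exists>K. s \<in> T \<longrightarrow> K \<in> \<C> s \<and> L s K \<subseteq> A" for s
  proof (cases "s \<in> T")
    case True
    then obtain n where "s = e n" using e by blast
    then show ?thesis using A(3)[rule_format, of n] unfolding \<H>_def by auto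
  qed auto
  then obtain \<kappa> where \<kappa>: "\<And>s. s \<in> T \<Longrightarrow> \<kappa> s \<in> \<C> s \<and> L s (\<kappa> s) \<subseteq> A" by metis
  define s where "s = rec_nat s0 (\<lambda>_ t. step t (\<kappa> t))"
  have s: "s 0 = s0" "\<And>n. s (Suc n) = step (s n) (\<kappa> (s n))" by (simp_all add: s_def)
  have sT: "s n \<in> T" for n by (induction n) (use s T \<kappa> in auto)
  show ?thesis
  proof (rule that[of s "\<lambda>n. \<kappa> (s n)" A])
    show "compactin X (\<kappa> (s n))" for n
      using \<C>(2) T(3) \<kappa> sT by blast
  qed (use s sT T(3) \<kappa> A in auto)
qed

section \<open>Baire category\<close>

lemma dense_in_meets_open:
  "dense_in Z S \<Longrightarrow> openin Z T \<Longrightarrow> T \<noteq> {} \<Longrightarrow> S \<inter> T \<noteq> {}"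
  unfolding dense_in_def dense_intersects_open by blast

lemma dense_inI:
  assumes "S \<subseteq> topspace Z" "\<And>T. openin Z T \<Longrightarrow> T \<noteq> {} \<Longrightarrow> S \<inter> T \<noteq> {}"
  shows "dense_in Z S"
  using assms unfolding dense_in_def dense_intersects_open by blast

text \<open>Complements of closures of nowhere dense sets are open and dense, and a common point
  lies in none of these sets. The empty space is both Baire and meager, hence the second
  hypothesis.\<close>

lemma Baire_space_imp_not_meager_space:
  assumes "Baire_space Z" "topspace Z \<noteq> {}"
  shows "\<not> meager_space Z"
proof
  assume "meager_space Z"
  then obtain \<N> where N: "countable \<N>" "\<forall>S\<in>\<N>. nowhere_dense_in Z S" "topspace Z = \<Union>\<N>"
    unfolding meager_space_def by (elim exE conjE)
  define \<G> where "\<G> = (\<lambda>S. topspace Z - Z closure_of S) ` \<N>"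
  have "openin Z G \<and> dense_in Z G" if G: "G \<in> \<G>" for G
  proof -
    obtain S where S: "S \<in> \<N>" "G = topspace Z - Z closure_of S" using G unfolding \<G>_def by auto
    then have "Z interior_of (Z closure_of S) = {}"
      using N(2) by (simp add: nowhere_dense_in_def)
    then show ?thesis
      using S(2) by (simp add: dense_in_def closure_of_complement openin_diff)
  qed
  moreover have "countable \<G>" using N(1) by (simp add: \<G>_def)
  ultimately have d: "dense_in Z (topspace Z \<inter> \<Inter>\<G>)"
    using assms(1) unfolding Baire_space_def by simp
  have "topspace Z \<inter> \<Inter>\<G> \<inter> topspace Z \<noteq> {}"
    by (rule dense_in_meets_open[OF d]) (use assms(2) in auto)
  then obtain z where z: "z \<in> topspace Z" "\<And>G. G \<in> \<G> \<Longrightarrow> z \<in> G" by auto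
  then obtain S where S: "S \<in> \<N>" "z \<in> S" using N(3) by auto
  have "S \<subseteq> Z closure_of S"
    using N(2) S(1) by (intro closure_of_subset) (simp add: nowhere_dense_in_def)
  moreover have "z \<in> topspace Z - Z closure_of S"
    by (rule z(2)) (use S(1) in \<open>simp add: \<G>_def\<close>)
  ultimately show False using S(2) by auto
qed

text \<open>The complements of the \<open>G n\<close> are nowhere dense and would cover
  \<open>Z\<close> if the \<open>G n\<close> had no common point.\<close>

lemma not_meager_space_Inter_dense_nonempty:
  fixes G :: "nat \<Rightarrow> 'z set"
  assumes "\<not> meager_space Z" "\<And>n. openin Z (G n)" "\<And>n. dense_in Z (G n)"
  shows "\<exists>z\<in>topspace Z. \<forall>n. z \<in> G n"
proof (rule ccontr)
  assume none: "\<not> ?thesis"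
  have "nowhere_dense_in Z (topspace Z - G n)" for n
  proof -
    have "closedin Z (topspace Z - G n)" using assms(2) by auto
    then have "Z closure_of (topspace Z - G n) = topspace Z - G n"
      by (rule closure_of_closedin)
    moreover have "Z interior_of (topspace Z - G n) = {}"
      using assms(3)[of n] by (simp add: dense_in_def interior_of_complement)
    ultimately show ?thesis by (simp add: nowhere_dense_in_def)
  qed
  moreover have "topspace Z = (\<Union>n. topspace Z - G n)" using none by auto
  ultimately have "meager_space Z"
    unfolding meager_space_def
    by (intro exI[of _ "range (\<lambda>n. topspace Z - G n)"]) auto
  with assms(1) show False by simp
qed

text \<open>The given finite families need not be nested, but they show that some member avoids any
  given finite set; so a disjoint family can grow one member at a time.\<close>

lemma infinite_disjoint_subfamily:
  fixes \<A> :: "'a set set"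
  assumes fin: "\<And>A. A \<in> \<A> \<Longrightarrow> finite A \<and> A \<noteq> {}"
    and large: "\<And>n. \<exists>\<D>\<subseteq>\<A>. finite \<D> \<and> card \<D> = n \<and> pairwise disjnt \<D>"
  shows "\<exists>\<D>\<subseteq>\<A>. infinite \<D> \<and> pairwise disjnt \<D>"
proof -
  have avoid: "\<exists>A\<in>\<A>. A \<inter> S = {}" if S: "finite S" for S
  proof (rule ccontr)
    assume none: "\<not> ?thesis"
    \<comment> \<open>Pigeonhole: \<open>Suc (card S)\<close> disjoint sets cannot all meet
      \<open>S\<close>.\<close>
    obtain \<D> where D: "\<D> \<subseteq> \<A>" "finite \<D>" "card \<D> = Suc (card S)" "pairwise disjnt \<D>"
      using large by metis
    have "\<forall>A\<in>\<D>. \<exists>x. x \<in> A \<inter> S" using none D(1) by auto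
    from bchoice[OF this] obtain g where g: "\<forall>A\<in>\<D>. g A \<in> A \<inter> S" ..
    have "inj_on g \<D>"
    proof (rule inj_onI, rule ccontr)
      fix A B assume "A \<in> \<D>" "B \<in> \<D>" "g A = g B" "A \<noteq> B"
      then show False using g D(4) unfolding pairwise_def disjnt_iff by (metis IntD1)
    qed
    moreover have "g ` \<D> \<subseteq> S" using g by auto
    ultimately have "card \<D> \<le> card S" using S by (metis card_inj_on_le)
    then show False using D(3) by simp
  qed
  define P where "P n \<D> \<longleftrightarrow> \<D> \<subseteq> \<A> \<and> finite \<D> \<and> card \<D> = n \<and> pairwise disjnt \<D>" for n \<D>
  have "\<exists>f. \<forall>n. P n (f n) \<and> f n \<subseteq> f (Suc n)"
  proof (rule dependent_nat_choice)
    show "\<exists>\<D>. P 0 \<D>" by (intro exI[of _ "{}"]) (simp add: P_def)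
    fix \<D> n assume P: "P n \<D>"
    then have "finite (\<Union>\<D>)" using fin by (auto simp: P_def)
    from avoid[OF this] obtain A where A: "A \<in> \<A>" "A \<inter> \<Union>\<D> = {}" by blast
    have "A \<notin> \<D>" using A fin[OF A(1)] by blast
    moreover have "pairwise disjnt (insert A \<D>)"
      using P A(2) unfolding pairwise_insert P_def by (auto simp: disjnt_def)
    ultimately have "P (Suc n) (insert A \<D>)" using P A(1) by (simp add: P_def)
    then show "\<exists>\<D>'. P (Suc n) \<D>' \<and> \<D> \<subseteq> \<D>'" by auto
  qed
  then obtain f where f: "\<And>n. P n (f n)" "\<And>n. f n \<subseteq> f (Suc n)" by auto
  have mono: "f i \<subseteq> f j" if "i \<le> j" for i j
    using f(2) that by (rule lift_Suc_mono_le)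
  have "infinite (\<Union>n. f n)"
  proof
    assume "finite (\<Union>n. f n)"
    then have "card (f (Suc (card (\<Union>n. f n)))) \<le> card (\<Union>n. f n)"
      by (intro card_mono) auto
    then show False using f(1)[of "Suc (card (\<Union>n. f n))"] by (simp add: P_def)
  qed
  moreover have "pairwise disjnt (\<Union>n. f n)"
  proof (rule pairwiseI)
    fix A B assume "A \<in> (\<Union>n. f n)" "B \<in> (\<Union>n. f n)" "A \<noteq> B"
    then obtain i j where "A \<in> f i" "B \<in> f j" by auto
    then have "A \<in> f (max i j)" "B \<in> f (max i j)"
      using mono[of i "max i j"] mono[of j "max i j"] by auto
    then show "disjnt A B"
      using f(1)[of "max i j"] \<open>A \<noteq> B\<close> unfolding P_def pairwise_def by auto
  qed
  moreover have "(\<Union>n. f n) \<subseteq> \<A>" using f(1) by (auto simp: P_def)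
  ultimately show ?thesis by (intro exI[of _ "\<Union>n. f n"] conjI)
qed

section \<open>Maps constant on the non-isolated points\<close>

lemma openin_Ck'_image_subset:
  assumes "compactin X K" "openin Y U"
  shows "openin (Ck' X Y y) {f \<in> topspace (Ck' X Y y). f ` K \<subseteq> U}"
proof -
  have "openin (Ck X Y) {f \<in> cont_maps X Y. f ` K \<subseteq> U}"
    unfolding Ck_def using assms by (intro topology_generated_by_Basis) auto
  then have "openin (Ck' X Y y)
      ({f \<in> cont_maps X Y. f ` nonisolated_points X \<subseteq> {y}} \<inter> {f \<in> cont_maps X Y. f ` K \<subseteq> U})"
    unfolding Ck'_def by (rule openin_subtopology_Int2)
  then show ?thesis by (rule back_subst) auto
qed

text \<open>The preimage of an open set missing \<open>y\<close> consists of isolated points and is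
  open anyway, so only neighbourhoods of \<open>y\<close> need a check.\<close>

lemma Ck'I:
  assumes "f \<in> extensional (topspace X)" "\<And>x. x \<in> topspace X \<Longrightarrow> f x \<in> topspace Y"
    and "\<And>x. x \<in> nonisolated_points X \<Longrightarrow> f x = y"
    and "\<And>V. openin Y V \<Longrightarrow> y \<in> V \<Longrightarrow> closedin X {x \<in> topspace X. f x \<notin> V}"
  shows "f \<in> topspace (Ck' X Y y)"
proof -
  have "openin X {x \<in> topspace X. f x \<in> V}" if V: "openin Y V" for V
  proof (cases "y \<in> V")
    case True
    have "{x \<in> topspace X. f x \<in> V} = topspace X - {x \<in> topspace X. f x \<notin> V}" by auto
    then show ?thesis using assms(4)[OF V True] by (metis openin_diff openin_topspace)
  next
    case False
    then show ?thesis using assms(3)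
      by (intro openin_subset_isolated_points) (auto simp: nonisolated_points_def)
  qed
  then show ?thesis
    using assms(1-3) by (auto simp: cont_maps_def continuous_map_def)
qed

lemma Ck'_closedin:
  assumes "f \<in> topspace (Ck' X Y y)" "openin Y V"
  shows "closedin X {x \<in> topspace X. f x \<notin> V}"
proof -
  have "openin X {x \<in> topspace X. f x \<in> V}"
    using assms by (auto simp: cont_maps_def intro: openin_continuous_map_preimage)
  then have "closedin X (topspace X - {x \<in> topspace X. f x \<in> V})" by auto
  then show ?thesis by (rule back_subst) auto
qed

lemma Ck'_range:
  "f \<in> topspace (Ck' X Y y) \<Longrightarrow> x \<in> topspace X \<Longrightarrow> f x \<in> topspace Y"
  by (auto simp: cont_maps_def continuous_map_def)

text \<open>The sets tested in \<open>Ck'I\<close> change only inside \<open>S\<close>, a finite set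
  all of whose subsets are clopen.\<close>

lemma Ck'_override:
  assumes h: "h \<in> topspace (Ck' X Y y)"
    and S: "finite S" "S \<subseteq> isolated_points X" "\<And>x. x \<in> S \<Longrightarrow> g x \<in> topspace Y"
  shows "(\<lambda>x. if x \<in> S then g x else h x) \<in> topspace (Ck' X Y y)"
proof (rule Ck'I)
  have ST: "S \<subseteq> topspace X" using subset_trans[OF S(2) isolated_points_subset_topspace] .
  show "(\<lambda>x. if x \<in> S then g x else h x) \<in> extensional (topspace X)"
    using h ST by (auto simp: cont_maps_def extensional_def)
  show "(if x \<in> S then g x else h x) \<in> topspace Y" if "x \<in> topspace X" for x
    using that S(3) Ck'_range[OF h] by simp
  show "(if x \<in> S then g x else h x) = y" if "x \<in> nonisolated_points X" for x
    using that h S(2) by (auto simp: nonisolated_points_def)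
  fix V assume V: "openin Y V" "y \<in> V"
  have "closedin X (({x \<in> topspace X. h x \<notin> V} - S) \<union> {x \<in> S. g x \<notin> V})"
    using Ck'_closedin[OF h V(1)] S openin_subset_isolated_points[OF S(2)]
    by (intro closedin_Un closedin_diff closedin_finite_isolated_points[of "{x \<in> S. g x \<notin> V}"]) auto
  then show "closedin X {x \<in> topspace X. (if x \<in> S then g x else h x) \<notin> V}"
    by (rule back_subst) (use ST in auto)
qed

lemma Ck'_const:
  assumes "y \<in> topspace Y"
  shows "(\<lambda>x\<in>topspace X. y) \<in> topspace (Ck' X Y y)"
  by (rule Ck'I) (use assms in \<open>auto simp: nonisolated_points_def\<close>)

lemma Ck'_topspace_nonempty: "y \<in> topspace Y \<Longrightarrow> topspace (Ck' X Y y) \<noteq> {}"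
  using Ck'_const by fastforce

text \<open>A compact set sent into an open set missing the base point consists of
  isolated points, hence is finite and can be put into \<open>F\<close>. The alternative \<open>f x \<in> U x\<close> on
  \<open>K - F\<close> is what makes the condition stable under finite intersections.\<close>

lemma Ck'_neighbourhood:
  assumes Q: "openin (Ck' X Y y) Q" and h: "h \<in> Q" and y: "y \<in> topspace Y"
  shows "\<exists>K V F U. compactin X K \<and> openin Y V \<and> y \<in> V \<and> finite F \<and> F \<subseteq> isolated_points X \<and>
    (\<forall>x\<in>topspace X. openin Y (U x) \<and> h x \<in> U x) \<and>
    (\<forall>f\<in>topspace (Ck' X Y y). (\<forall>x\<in>F. f x \<in> U x) \<and> (\<forall>x\<in>K - F. f x \<in> U x \<union> V) \<longrightarrow> f \<in> Q)"
proof -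
  let ?T = "topspace (Ck' X Y y)"
  have hT: "h \<in> ?T" using Q h openin_subset by blast
  define good where "good R K V F U \<longleftrightarrow>
    compactin X K \<and> openin Y V \<and> y \<in> V \<and> finite F \<and> F \<subseteq> isolated_points X \<and>
    (\<forall>x\<in>topspace X. openin Y (U x) \<and> h x \<in> U x) \<and>
    (\<forall>f\<in>?T. (\<forall>x\<in>F. f x \<in> U x) \<and> (\<forall>x\<in>K - F. f x \<in> U x \<union> V) \<longrightarrow> f \<in> R)"
    for R K V F U
  obtain R where R: "openin (Ck X Y) R" "Q = R \<inter> {f \<in> cont_maps X Y. f ` nonisolated_points X \<subseteq> {y}}"
    using Q unfolding Ck'_def openin_subtopology by blast
  have "generate_topology_on {{f \<in> cont_maps X Y. f ` K \<subseteq> U} | K U. compactin X K \<and> openin Y U} R"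
    using R(1) unfolding Ck_def by (rule openin_topology_generated_by)
  then have "h \<in> R \<longrightarrow> (\<exists>K V F U. good R K V F U)"
  proof induction
    case Empty
    then show ?case by simp
  next
    case (Int a b)
    show ?case
    proof
      assume "h \<in> a \<inter> b"
      then obtain K1 V1 F1 U1 K2 V2 F2 U2 where g: "good a K1 V1 F1 U1" "good b K2 V2 F2 U2"
        using Int.IH by auto
      have "good (a \<inter> b) (K1 \<union> K2) (V1 \<inter> V2) (F1 \<union> F2) (\<lambda>x. U1 x \<inter> U2 x)"
        unfolding good_def
      proof (intro conjI ballI impI)
        fix f assume f: "f \<in> ?T" "(\<forall>x\<in>F1 \<union> F2. f x \<in> U1 x \<inter> U2 x) \<and>
          (\<forall>x\<in>K1 \<union> K2 - (F1 \<union> F2). f x \<in> U1 x \<inter> U2 x \<union> V1 \<inter> V2)"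
        have "(\<forall>x\<in>F1. f x \<in> U1 x) \<and> (\<forall>x\<in>K1 - F1. f x \<in> U1 x \<union> V1)"
          "(\<forall>x\<in>F2. f x \<in> U2 x) \<and> (\<forall>x\<in>K2 - F2. f x \<in> U2 x \<union> V2)"
          using f(2) by blast+
        then show "f \<in> a \<inter> b" using g f(1) unfolding good_def by simp
      qed (use g in \<open>auto simp: good_def compactin_Un\<close>)
      then show "\<exists>K V F U. good (a \<inter> b) K V F U" by (intro exI)
    qed
  next
    case (UN \<K>)
    show ?case
    proof
      assume "h \<in> \<Union>\<K>"
      then obtain k where k: "k \<in> \<K>" "h \<in> k" by auto
      then obtain K V F U where "good k K V F U" using UN.IH[OF k(1)] by blast
      then have "good (\<Union>\<K>) K V F U" using k(1) unfolding good_def by auto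
      then show "\<exists>K V F U. good (\<Union>\<K>) K V F U" by (intro exI)
    qed
  next
    case (Basis s)
    then obtain K W where s: "s = {f \<in> cont_maps X Y. f ` K \<subseteq> W}" "compactin X K" "openin Y W"
      by auto
    have KT: "K \<subseteq> topspace X" using s(2) compactin_subset_topspace by blast
    show ?case
    proof
      assume "h \<in> s"
      then have hK: "h x \<in> W" if "x \<in> K" for x using that s(1) by auto
      define U where "U x = (if x \<in> K then W else topspace Y)" for x
      have U: "\<forall>x\<in>topspace X. openin Y (U x) \<and> h x \<in> U x"
        using hK s(3) Ck'_range[OF hT] by (simp add: U_def)
      show "\<exists>K V F U. good s K V F U"
      proof (cases "y \<in> W")
        case True
        \<comment> \<open>Here \<open>V = W\<close> controls all of \<open>K\<close>, which may be
          infinite.\<close>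
        have "good s K W {} U"
          unfolding good_def using U s True by (auto simp: U_def)
        then show ?thesis by (intro exI)
      next
        case False
        have "K \<subseteq> isolated_points X"
          using hK hT KT False by (auto simp: nonisolated_points_def)
        moreover from this have "finite K"
          using finite_compactin_isolated_points s(2) by blast
        ultimately have "good s K (topspace Y) K U"
          unfolding good_def using U s y by (auto simp: U_def)
        then show ?thesis by (intro exI)
      qed
    qed
  qed
  then obtain K V F U where g: "good R K V F U" using h R(2) by auto
  have "good Q K V F U"
    using g unfolding good_def R(2) by auto
  then show ?thesis unfolding good_def by (intro exI)
qed

text \<open>As \<open>F\<close> is open, \<open>K - F\<close> is compact, and the box is a finite
  intersection of sets as in \<open>openin_Ck'_image_subset\<close>.\<close>

lemma openin_Ck'_box:
  assumes "compactin X K" "openin Y V" "finite F" "F \<subseteq> isolated_points X"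
    and "\<And>x. x \<in> F \<Longrightarrow> openin Y (W x)"
  shows "openin (Ck' X Y y)
    {f \<in> topspace (Ck' X Y y). (\<forall>x\<in>F. f x \<in> W x) \<and> (\<forall>x\<in>K - F. f x \<in> V)}" (is "openin ?Z ?B")
proof -
  let ?N = "\<lambda>K U. {f \<in> topspace ?Z. f ` K \<subseteq> U}"
  have KF: "compactin X (K - F)"
  proof -
    have "compactin X (K \<inter> (topspace X - F))"
      using assms by (intro compact_Int_closedin closedin_diff openin_subset_isolated_points) auto
    moreover have "K \<inter> (topspace X - F) = K - F"
      using compactin_subset_topspace[OF assms(1)] by auto
    ultimately show ?thesis by simp
  qed
  have "openin ?Z (?N (K - F) V \<inter> (topspace ?Z \<inter> \<Inter>((\<lambda>x. ?N {x} (W x)) ` F)))"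
  proof (rule openin_Int)
    show "openin ?Z (?N (K - F) V)" using KF assms(2) by (rule openin_Ck'_image_subset)
    have "openin ?Z (\<Inter>(insert (topspace ?Z) ((\<lambda>x. ?N {x} (W x)) ` F)))"
    proof (rule openin_Inter)
      show "openin ?Z S" if S: "S \<in> insert (topspace ?Z) ((\<lambda>x. ?N {x} (W x)) ` F)" for S
      proof (cases "S = topspace ?Z")
        case False
        then obtain x where x: "x \<in> F" "S = ?N {x} (W x)" using S by blast
        have "x \<in> topspace X" using subset_trans[OF assms(4) isolated_points_subset_topspace] x(1) by (rule subsetD)
        then show ?thesis
          unfolding x(2) using x(1) assms(5) by (intro openin_Ck'_image_subset) auto
      qed (simp del: topspace_Ck')
    qed (use assms(3) in auto)
    then show "openin ?Z (topspace ?Z \<inter> \<Inter>((\<lambda>x. ?N {x} (W x)) ` F))" by simp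
  qed
  then show ?thesis by (rule back_subst) auto
qed

section \<open>From non-meagerness to DMOP\<close>

lemma not_meager_Ck'_imp_DMOP:
  assumes y: "y \<in> topspace Y" and adm: "admissible_at Y y" and nm: "\<not> meager_space (Ck' X Y y)"
  shows "DMOP X"
  unfolding DMOP_def
proof (intro allI impI, elim conjE)
  fix \<F> assume F: "\<forall>F\<in>\<F>. finite F \<and> F \<subseteq> isolated_points X" and mo: "moving_off X \<F>"
  let ?Z = "Ck' X Y y"
  obtain N U where N: "N \<subseteq> topspace Y" "openin Y U" "y \<in> U" "U \<subseteq> N" "\<not> dense_in Y N"
    using adm unfolding admissible_at_def by blast
  \<comment> \<open>By admissibility, a non-empty open set disjoint from the neighbourhood
    \<open>U\<close> of \<open>y\<close>.\<close>
  define W where "W = topspace Y - Y closure_of N"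
  have W: "openin Y W" "W \<inter> U = {}" "W \<noteq> {}"
  proof -
    show "openin Y W" unfolding W_def by (intro openin_diff) auto
    have "N \<subseteq> Y closure_of N" using N(1) by (rule closure_of_subset)
    then show "W \<inter> U = {}" unfolding W_def using N(4) by blast
    show "W \<noteq> {}"
      using N(1,5) closure_of_subset_topspace[of Y N] unfolding W_def dense_in_def by blast
  qed
  then obtain w where w: "w \<in> W" by blast
  have wY: "w \<in> topspace Y" using w W_def by auto
  define \<A> where "\<A> = {F \<in> \<F>. F \<noteq> {}}"
  define Ds where "Ds n = {\<D>. \<D> \<subseteq> \<A> \<and> finite \<D> \<and> card \<D> = n \<and> pairwise disjnt \<D>}" for n
  have Ds_finite: "finite (\<Union>\<D>) \<and> \<Union>\<D> \<subseteq> isolated_points X" if "\<D> \<in> Ds n" for \<D> n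
    using that F unfolding Ds_def \<A>_def by auto
  have comp: "compactin X S" if "finite S" "S \<subseteq> isolated_points X" for S
    using that isolated_points_subset_topspace by (metis finite_imp_compactin subset_trans)
  \<comment> \<open>Members chosen so far are finite, so their union with \<open>K\<close> is
    compact and is avoided by a further member.\<close>
  have off: "\<exists>\<D>\<in>Ds n. \<Union>\<D> \<inter> K = {}" if K: "compactin X K" for K n
  proof (induction n)
    case 0
    show ?case by (rule bexI[of _ "{}"]) (auto simp: Ds_def)
  next
    case (Suc n)
    then obtain \<D> where D: "\<D> \<in> Ds n" "\<Union>\<D> \<inter> K = {}" by (rule bexE)
    have "compactin X (K \<union> \<Union>\<D>)"
      using K comp Ds_finite[OF D(1)] by (intro compactin_Un) auto
    then obtain A where A: "A \<in> \<F>" "A \<noteq> {}" "(K \<union> \<Union>\<D>) \<inter> A = {}"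
      using mo unfolding moving_off_def by blast
    have "A \<notin> \<D>" using A(2,3) by blast
    moreover have "pairwise disjnt (insert A \<D>)"
      using D(1) A(3) unfolding pairwise_insert Ds_def by (auto simp: disjnt_def)
    ultimately have "insert A \<D> \<in> Ds (Suc n)"
      using D(1) A(1,2) by (simp add: Ds_def \<A>_def)
    moreover have "\<Union>(insert A \<D>) \<inter> K = {}" using D(2) A(3) by auto
    ultimately show ?case by (rule bexI[rotated])
  qed
  define G where "G n = (\<Union>\<D>\<in>Ds n. {f \<in> topspace ?Z. f ` (\<Union>\<D>) \<subseteq> W})" for n
  have "openin ?Z (G n)" for n
    unfolding G_def using Ds_finite comp W(1)
    by (intro openin_Union) (auto intro!: openin_Ck'_image_subset simp del: topspace_Ck')
  moreover have "dense_in ?Z (G n)" for n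
  proof (rule dense_inI)
    show "G n \<subseteq> topspace ?Z" unfolding G_def by blast
    fix T assume T: "openin ?Z T" "T \<noteq> {}"
    then obtain h where h: "h \<in> T" by blast
    have hZ: "h \<in> topspace ?Z" using h T(1) openin_subset by blast
    obtain K V E U' where K: "compactin X K" "finite E" "E \<subseteq> isolated_points X"
      "\<forall>x\<in>topspace X. openin Y (U' x) \<and> h x \<in> U' x"
      "\<forall>f\<in>topspace ?Z. (\<forall>x\<in>E. f x \<in> U' x) \<and> (\<forall>x\<in>K - E. f x \<in> U' x \<union> V) \<longrightarrow> f \<in> T"
      using Ck'_neighbourhood[OF T(1) h y] by (elim exE conjE)
    have KE: "compactin X (K \<union> E)" using K comp by (intro compactin_Un) auto
    then have KET: "K \<union> E \<subseteq> topspace X" by (rule compactin_subset_topspace)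
    from off[OF KE] obtain \<D> where D: "\<D> \<in> Ds n" "\<Union>\<D> \<inter> (K \<union> E) = {}" by (rule bexE)
    \<comment> \<open>Only values off \<open>K \<union> E\<close> change, so \<open>f\<close> stays
      in \<open>T\<close>.\<close>
    define f where "f = (\<lambda>x. if x \<in> \<Union>\<D> then w else h x)"
    have fZ: "f \<in> topspace ?Z"
      unfolding f_def using Ds_finite[OF D(1)] hZ wY by (intro Ck'_override) auto
    have "f x = h x" if "x \<in> K \<union> E" for x using that D(2) unfolding f_def by auto
    then have "f \<in> T" using K(4,5) fZ KET by (simp add: subset_iff)
    moreover have "f ` (\<Union>\<D>) \<subseteq> W" using w unfolding f_def by auto
    ultimately show "G n \<inter> T \<noteq> {}" using D(1) fZ unfolding G_def by blast
  qed
  ultimately obtain f where f: "f \<in> topspace ?Z" "\<And>n. f \<in> G n"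
    using not_meager_space_Inter_dense_nonempty[OF nm] by metis
  \<comment> \<open>The families witnessing \<open>f \<in> G n\<close> for different
    \<open>n\<close> are unrelated; an infinite one is assembled from all members sent into
    \<open>W\<close>.\<close>
  have "\<exists>\<D>\<subseteq>{A \<in> \<A>. f ` A \<subseteq> W}. infinite \<D> \<and> pairwise disjnt \<D>"
  proof (rule infinite_disjoint_subfamily)
    show "finite A \<and> A \<noteq> {}" if "A \<in> {A \<in> \<A>. f ` A \<subseteq> W}" for A
      using that F by (simp add: \<A>_def)
    fix n
    obtain \<D> where "\<D> \<in> Ds n" "f ` (\<Union>\<D>) \<subseteq> W" using f(2)[of n] unfolding G_def
      by (elim UN_E CollectE conjE)
    then show "\<exists>\<D>\<subseteq>{A \<in> \<A>. f ` A \<subseteq> W}. finite \<D> \<and> card \<D> = n \<and> pairwise disjnt \<D>"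
      unfolding Ds_def by (intro exI[of _ \<D>]) auto
  qed
  then obtain \<D> where D: "\<D> \<subseteq> {A \<in> \<A>. f ` A \<subseteq> W}" "infinite \<D>" "pairwise disjnt \<D>"
    by (elim exE conjE)
  have "discrete_family_in X \<D>"
    unfolding discrete_family_in_def
  proof
    fix x assume x: "x \<in> topspace X"
    show "\<exists>U. openin X U \<and> x \<in> U \<and> (\<forall>A\<in>\<D>. \<forall>B\<in>\<D>. A \<inter> U \<noteq> {} \<and> B \<inter> U \<noteq> {} \<longrightarrow> A = B)"
    proof (cases "x \<in> isolated_points X")
      case True
      then have "openin X {x}" by (intro openin_subset_isolated_points) simp
      moreover have "\<forall>A\<in>\<D>. \<forall>B\<in>\<D>. A \<inter> {x} \<noteq> {} \<and> B \<inter> {x} \<noteq> {} \<longrightarrow> A = B"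
        using D(3) unfolding pairwise_def disjnt_def by blast
      ultimately show ?thesis by (intro exI[of _ "{x}"]) simp
    next
      case False
      \<comment> \<open>The preimage of \<open>U\<close> is a neighbourhood of \<open>x\<close>
        missing every member of \<open>\<D>\<close>, since these are sent into
        \<open>W\<close>.\<close>
      then have "f x = y" using f(1) x by (auto simp: nonisolated_points_def)
      moreover have "openin X {x \<in> topspace X. f x \<in> U}"
        using f(1) N(2) by (auto simp: cont_maps_def intro: openin_continuous_map_preimage)
      moreover have "A \<inter> {x \<in> topspace X. f x \<in> U} = {}" if "A \<in> \<D>" for A
        using subsetD[OF D(1) that] W(2) by auto
      ultimately show ?thesis using x N(3)
        by (intro exI[of _ "{x \<in> topspace X. f x \<in> U}"]) simp
    qed
  qed
  moreover have "\<D> \<subseteq> \<F>" using D(1) unfolding \<A>_def by auto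
  ultimately show "\<exists>\<D>\<subseteq>\<F>. infinite \<D> \<and> discrete_family_in X \<D>"
    using D(2) by (intro exI[of _ \<D>]) simp
qed

section \<open>The game on the function space\<close>

lemma E_moves_legal_append:
  "E_moves_legal Z \<sigma> us \<Longrightarrow> openin Z U \<Longrightarrow> U \<noteq> {} \<Longrightarrow> (us \<noteq> [] \<Longrightarrow> U \<subseteq> \<sigma> us) \<Longrightarrow>
    E_moves_legal Z \<sigma> (us @ [U])"
  unfolding E_moves_legal_def by (auto simp: nth_append less_Suc_eq)

lemma E_moves_legal_take:
  "E_moves_legal Z \<sigma> us \<Longrightarrow> E_moves_legal Z \<sigma> (take n us)"
  unfolding E_moves_legal_def by (auto simp: min_def)

lemma E_moves_legal_last:
  assumes "E_moves_legal Z \<sigma> us" "us \<noteq> []"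
  shows "openin Z (last us)" "last us \<noteq> {}"
  using assms(1)[unfolded E_moves_legal_def, rule_format, of "length us - 1"] assms(2)
  by (simp_all add: last_conv_nth)

text \<open>The finite plays are stages of one infinite play, which N wins. An empty
  \<open>us 0\<close> has no last move and is exempted.\<close>

lemma winning_strategy_N_extending_plays:
  assumes \<sigma>: "winning_strategy_N Z \<sigma>"
    and legal: "\<And>n. E_moves_legal Z \<sigma> (us n)"
    and extend: "\<And>n. \<exists>U. us (Suc n) = us n @ [U]"
  shows "\<exists>z. \<forall>n. us n \<noteq> [] \<longrightarrow> z \<in> last (us n)"
proof -
  \<comment> \<open>\<open>us (Suc k)\<close> has length at least \<open>Suc k\<close>, so index
    \<open>k\<close> is in range, and later plays agree there.\<close>
  define U where "U k = us (Suc k) ! k" for k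
  have len: "length (us n) = length (us 0) + n" for n
  proof (induction n)
    case (Suc n)
    then show ?case using extend[of n] by auto
  qed simp
  have prefix: "us i ! k = us j ! k" if "i \<le> j" "k < length (us i)" for i j k
    using that(1)
  proof (induction j rule: dec_induct)
    case (step j)
    have "k < length (us j)" using that(2) step.hyps(1) len[of i] len[of j] by simp
    moreover obtain U where "us (Suc j) = us j @ [U]" using extend by blast
    ultimately show ?case using step.IH by (simp add: nth_append)
  qed simp
  have nth: "us n ! k = U k" if "k < length (us n)" for n k
  proof (cases "n \<le> Suc k")
    case True
    then show ?thesis unfolding U_def using that by (intro prefix)
  next
    case False
    then show ?thesis unfolding U_def
      using that len[of "Suc k"] by (intro prefix[symmetric]) auto
  qed
  have "map U [0..<n] = take n (us n)" for n
    by (rule nth_equalityI) (use len[of n] nth[of _ n] in auto)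
  then have "\<forall>n. E_moves_legal Z \<sigma> (map U [0..<n])"
    using E_moves_legal_take[OF legal] by simp
  then have "(\<Inter>n. U n) \<noteq> {}"
    using \<sigma> unfolding winning_strategy_N_def by simp
  then obtain z where z: "\<And>n. z \<in> U n" by auto
  have "z \<in> last (us n)" if "us n \<noteq> []" for n
    using that z nth[of "length (us n) - 1" n] by (simp add: last_conv_nth)
  then show ?thesis by (intro exI[of _ z]) simp
qed

text \<open>A position stands for the open set \<open>box\<close> of maps whose values at the isolated points in
  \<open>support\<close> lie in the last move of a play of the Choquet game on \<open>Y\<close> (one play per
  point), and whose values on the rest of \<open>core\<close> lie in the basic neighbourhood number
  \<open>level\<close> of the base point.\<close>

datatype ('a, 'b) position =
  Position (stage: nat) (core: "'a set") (support: "'a set")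
    (history: "'a \<Rightarrow> 'b set list") (level: nat)

section \<open>Positions and their refinements\<close>

locale function_space_game =
  fixes X :: "'a topology" and Y :: "'b topology" and pt :: 'b
    and \<sigma> :: "'b set list \<Rightarrow> 'b set" and V :: "nat \<Rightarrow> 'b set"
  assumes pt: "pt \<in> topspace Y"
    and \<sigma>: "winning_strategy_N Y \<sigma>"
    and openV: "openin Y (V n)" and ptV: "pt \<in> V n"
    and decV: "V (Suc n) \<subseteq> V n"
    and baseV: "openin Y U \<Longrightarrow> pt \<in> U \<Longrightarrow> \<exists>n. V n \<subseteq> U"
begin

lemma V_antimono: "m \<le> n \<Longrightarrow> V n \<subseteq> V m"
  by (rule lift_Suc_antimono_le[of V]) (rule decV)

text \<open>Empty histories off the support let an entering point begin its play by the same append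
  that continues older plays.\<close>

definition valid :: "('a, 'b) position \<Rightarrow> bool" where
  "valid s \<longleftrightarrow> compactin X (core s) \<and> finite (support s) \<and> support s \<subseteq> isolated_points X \<and>
    (\<forall>x\<in>support s. history s x \<noteq> []) \<and> (\<forall>x. x \<notin> support s \<longrightarrow> history s x = []) \<and>
    (\<forall>x. E_moves_legal Y \<sigma> (history s x))"

definition box :: "('a, 'b) position \<Rightarrow> ('a \<Rightarrow> 'b) set" where
  "box s = {f \<in> topspace (Ck' X Y pt). (\<forall>x\<in>support s. f x \<in> last (history s x)) \<and>
    (\<forall>x\<in>core s - support s. f x \<in> V (level s))}"

text \<open>The part of \<open>box s\<close> left after N has answered in all the plays and the core has been
  enlarged by \<open>C\<close>.\<close>

definition reply_box :: "('a, 'b) position \<Rightarrow> 'a set \<Rightarrow> ('a \<Rightarrow> 'b) set" where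
  "reply_box s C = {f \<in> topspace (Ck' X Y pt). (\<forall>x\<in>support s. f x \<in> \<sigma> (history s x)) \<and>
    (\<forall>x\<in>core s \<union> C - support s. f x \<in> V (level s))}"

text \<open>The last clause confines new support points in the region already controlled. Those
  outside it are left free and have to be caught by a closed set of isolated points.\<close>

definition refines :: "('a, 'b) position \<Rightarrow> 'a set \<Rightarrow> ('a, 'b) position \<Rightarrow> bool" where
  "refines s C t \<longleftrightarrow> valid t \<and> stage t = Suc (stage s) \<and> core s \<union> C \<subseteq> core t \<and>
    support s \<subseteq> support t \<and> level s < level t \<and>
    (\<forall>x\<in>support t. \<exists>U. history t x = history s x @ [U]) \<and>
    (\<forall>x\<in>support t \<inter> (core s \<union> C) - support s. last (history t x) \<subseteq> V (level s))"

lemma strategy_answer: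
  assumes "valid s" "x \<in> support s"
  shows "openin Y (\<sigma> (history s x))" "\<sigma> (history s x) \<noteq> {}"
  using assms \<sigma> unfolding winning_strategy_N_def valid_def by auto

lemma openin_reply_box:
  assumes "valid s" "compactin X C"
  shows "openin (Ck' X Y pt) (reply_box s C)"
  unfolding reply_box_def
  using assms strategy_answer(1)[OF assms(1)] openV
  by (intro openin_Ck'_box) (auto simp: valid_def compactin_Un)

lemma reply_box_nonempty:
  assumes "valid s" "compactin X C"
  shows "reply_box s C \<noteq> {}"
proof -
  have "\<forall>x\<in>support s. \<exists>y. y \<in> \<sigma> (history s x)"
    using strategy_answer(2)[OF assms(1)] by auto
  from bchoice[OF this] obtain g where g: "\<forall>x\<in>support s. g x \<in> \<sigma> (history s x)" ..
  define f where "f x = (if x \<in> support s then g x else (\<lambda>x\<in>topspace X. pt) x)" for x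
  have gY: "g x \<in> topspace Y" if "x \<in> support s" for x
    using g that openin_subset[OF strategy_answer(1)[OF assms(1) that]] by auto
  have "f \<in> topspace (Ck' X Y pt)"
    unfolding f_def
    by (rule Ck'_override[OF Ck'_const[OF pt]]) (use assms(1) gY in \<open>auto simp: valid_def\<close>)
  moreover have "core s \<union> C \<subseteq> topspace X"
    using assms by (auto simp: valid_def dest: compactin_subset_topspace)
  ultimately have "f \<in> reply_box s C"
    using g ptV unfolding reply_box_def f_def by auto
  then show ?thesis by auto
qed

text \<open>A map \<open>h\<close> in the intersection has a neighbourhood inside \<open>Q\<close>
  given by \<open>Ck'_neighbourhood\<close>: its compact set joins the core, its finite set joins
  the support, and its open sets, cut down, become E's next moves.\<close>

lemma refines_exists:
  assumes s: "valid s" and C: "compactin X C"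
    and Q: "openin (Ck' X Y pt) Q" "Q \<inter> reply_box s C \<noteq> {}"
  shows "\<exists>t. refines s C t \<and> box t \<subseteq> Q"
proof -
  obtain h where h: "h \<in> Q" "h \<in> reply_box s C" using Q(2) by auto
  obtain K W F U where K: "compactin X K" and W: "openin Y W" "pt \<in> W"
    and F: "finite F" "F \<subseteq> isolated_points X"
    and U: "\<forall>x\<in>topspace X. openin Y (U x) \<and> h x \<in> U x"
    and sub: "\<forall>f\<in>topspace (Ck' X Y pt).
      (\<forall>x\<in>F. f x \<in> U x) \<and> (\<forall>x\<in>K - F. f x \<in> U x \<union> W) \<longrightarrow> f \<in> Q"
    using Ck'_neighbourhood[OF Q(1) h(1) pt] by (elim exE conjE)
  obtain k where k: "V k \<subseteq> W" using baseV[OF W] by auto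
  \<comment> \<open>Large enough for \<open>V m \<subseteq> W\<close> and for the level to increase
    strictly.\<close>
  define m where "m = max k (Suc (level s))"
  \<comment> \<open>Old points must move inside N's answer, new controlled points inside
    \<open>V (level s)\<close>; \<open>h\<close> meets both demands, being in the reply box.\<close>
  define U' where "U' x = (if x \<in> support s then U x \<inter> \<sigma> (history s x)
    else if x \<in> core s \<union> C then U x \<inter> V (level s) else U x)" for x
  define t where "t = Position (Suc (stage s)) (core s \<union> C \<union> K) (support s \<union> F)
    (\<lambda>x. if x \<in> support s \<union> F then history s x @ [U' x] else []) m"
  have suppX: "support s \<union> F \<subseteq> topspace X"
    using s F(2) isolated_points_subset_topspace[of X] by (auto simp: valid_def)
  have U': "openin Y (U' x) \<and> h x \<in> U' x" if "x \<in> support s \<union> F" for x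
    using that suppX U strategy_answer(1)[OF s] h(2) openV
    by (auto simp: U'_def reply_box_def intro!: openin_Int)
  have "valid t"
    unfolding valid_def
  proof (intro conjI allI)
    show "E_moves_legal Y \<sigma> (history t x)" for x
    proof (cases "x \<in> support s \<union> F")
      case True
      have "U' x \<subseteq> \<sigma> (history s x)" if "history s x \<noteq> []"
        using that s by (auto simp: valid_def U'_def)
      then have "E_moves_legal Y \<sigma> (history s x @ [U' x])"
        using s U'[OF True] by (intro E_moves_legal_append) (auto simp: valid_def)
      then show ?thesis using True by (simp add: t_def)
    next
      case False
      then show ?thesis by (simp add: t_def E_moves_legal_def)
    qed
    show "compactin X (core t)"
      using s C K by (simp add: t_def valid_def compactin_Un)
  qed (use s F in \<open>auto simp: t_def valid_def\<close>)
  then have "refines s C t"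
    unfolding refines_def by (auto simp: t_def m_def U'_def)
  moreover have "box t \<subseteq> Q"
  proof
    fix f assume f: "f \<in> box t"
    then have fT: "f \<in> topspace (Ck' X Y pt)" unfolding box_def by blast
    have fU: "f x \<in> U' x" if "x \<in> support s \<union> F" for x
      using f that by (simp add: box_def t_def)
    have U'U: "U' x \<subseteq> U x" for x by (auto simp: U'_def)
    \<comment> \<open>On \<open>K - F\<close> the old support is constrained by \<open>U x\<close>
      and the rest by \<open>V m\<close>; hence the alternative in
      \<open>Ck'_neighbourhood\<close>.\<close>
    have "f x \<in> U x \<union> W" if "x \<in> K - F" for x
    proof (cases "x \<in> support s")
      case True
      then show ?thesis using fU[of x] U'U[of x] by auto
    next
      case False
      then have "f x \<in> V m" using f that by (simp add: box_def t_def)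
      then show ?thesis using k V_antimono[of k m] by (auto simp: m_def)
    qed
    moreover have "f x \<in> U x" if "x \<in> F" for x
      using fU[of x] U'U[of x] that by auto
    ultimately show "f \<in> Q" using sub fT by simp
  qed
  ultimately show ?thesis by (intro exI[of _ t]) simp
qed

text \<open>At points that ever enter the support, the value comes from the play won there;
  elsewhere it is \<open>pt\<close>. The map is continuous because points entering late lie in
  \<open>A\<close> or have values in a small \<open>V n\<close>.\<close>

lemma refines_limit:
  assumes ref: "\<And>n. refines (s n) (C n) (s (Suc n))" and valid: "\<And>n. valid (s n)"
    and A: "closedin X A" "A \<subseteq> isolated_points X"
      "\<And>n. support (s (Suc n)) - (support (s n) \<union> core (s n) \<union> C n) \<subseteq> A"
  shows "\<exists>f. \<forall>n. f \<in> box (s n)"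
proof -
  define S where "S = (\<Union>n. support (s n))"
  have supp_mono: "support (s i) \<subseteq> support (s j)" if "i \<le> j" for i j
    using that by (rule lift_Suc_mono_le[rotated]) (use ref in \<open>auto simp: refines_def\<close>)
  have core_mono: "core (s i) \<subseteq> core (s j)" if "i \<le> j" for i j
    using that by (rule lift_Suc_mono_le[rotated]) (use ref in \<open>auto simp: refines_def\<close>)
  have level_mono: "level (s i) \<le> level (s j)" if "i \<le> j" for i j
    using that by (rule lift_Suc_mono_le[rotated])
      (use ref in \<open>auto simp: refines_def intro: less_imp_le\<close>)
  have level_ge: "n \<le> level (s n)" for n
  proof (induction n)
    case (Suc n)
    have "level (s n) < level (s (Suc n))" using ref[of n] by (simp add: refines_def)
    then show ?case using Suc by simp
  qed simp
  have "\<exists>y. \<forall>n. x \<in> support (s n) \<longrightarrow> y \<in> last (history (s n) x)" if x: "x \<in> S" for x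
  proof -
    \<comment> \<open>Before stage \<open>N\<close> the history at \<open>x\<close> stays empty, so
      the play is read from \<open>N\<close> on.\<close>
    define N where "N = (LEAST n. x \<in> support (s n))"
    have N: "x \<in> support (s N)" unfolding N_def using x S_def by (auto intro: LeastI)
    have inN: "x \<in> support (s (N + n))" for n using N supp_mono[of N "N + n"] by auto
    have "\<exists>y. \<forall>n. history (s (N + n)) x \<noteq> [] \<longrightarrow> y \<in> last (history (s (N + n)) x)"
    proof (rule winning_strategy_N_extending_plays[OF \<sigma>])
      show "E_moves_legal Y \<sigma> (history (s (N + n)) x)" for n
        using valid by (simp add: valid_def)
      show "\<exists>U. history (s (N + Suc n)) x = history (s (N + n)) x @ [U]" for n
        using ref[of "N + n"] inN[of "Suc n"] by (simp add: refines_def)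
    qed
    then obtain y where y: "\<And>n. history (s (N + n)) x \<noteq> [] \<Longrightarrow> y \<in> last (history (s (N + n)) x)"
      by auto
    have "y \<in> last (history (s n) x)" if n: "x \<in> support (s n)" for n
    proof -
      have "N \<le> n" unfolding N_def using n by (rule Least_le)
      moreover have "history (s n) x \<noteq> []" using valid n by (simp add: valid_def)
      ultimately show ?thesis using y[of "n - N"] by simp
    qed
    then show ?thesis by (intro exI[of _ y]) simp
  qed
  then have "\<forall>x\<in>S. \<exists>y. \<forall>n. x \<in> support (s n) \<longrightarrow> y \<in> last (history (s n) x)" by simp
  from bchoice[OF this] obtain g
    where g: "\<forall>x\<in>S. \<forall>n. x \<in> support (s n) \<longrightarrow> g x \<in> last (history (s n) x)" ..
  define f where "f x = (if x \<in> S then g x else if x \<in> topspace X then pt else undefined)" for x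
  have SD: "S \<subseteq> isolated_points X" using valid unfolding S_def valid_def by blast
  then have ST: "S \<subseteq> topspace X" using isolated_points_subset_topspace[of X] by auto
  have fS: "f x \<in> last (history (s n) x)" if "x \<in> support (s n)" for x n
  proof -
    have "x \<in> S" using that by (auto simp: S_def)
    then show ?thesis using g that by (simp add: f_def)
  qed
  have entry: "\<exists>j\<ge>n. x \<in> support (s (Suc j)) - support (s j)"
    if x: "x \<in> S" "x \<notin> support (s n)" for x n
  proof -
    obtain i where i: "x \<in> support (s i)" using x(1) by (auto simp: S_def)
    have "n \<le> i" using i x(2) supp_mono[of i n] by (meson nat_le_linear subsetD)
    then show ?thesis using i
    proof (induction i rule: dec_induct)
      case base
      then show ?case using x(2) by simp
    next
      case (step i)
      then show ?case by (cases "x \<in> support (s i)") auto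
    qed
  qed
  \<comment> \<open>The move made on entry confines the value for good, and levels do not decrease
    from \<open>n\<close> to \<open>j\<close>.\<close>
  have small: "f x \<in> V (level (s n))"
    if x: "x \<in> support (s (Suc j)) - support (s j)" "x \<in> core (s j) \<union> C j" and "n \<le> j" for x n j
  proof -
    have "last (history (s (Suc j)) x) \<subseteq> V (level (s j))"
      using ref[of j] x unfolding refines_def by blast
    moreover have "f x \<in> last (history (s (Suc j)) x)" using x fS by simp
    ultimately show ?thesis using V_antimono[OF level_mono[OF \<open>n \<le> j\<close>]] by auto
  qed
  have fT: "f \<in> topspace (Ck' X Y pt)"
  proof (rule Ck'I)
    show "f \<in> extensional (topspace X)" using ST by (auto simp: f_def extensional_def)
    show "f x \<in> topspace Y" if "x \<in> topspace X" for x
    proof (cases "x \<in> S")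
      case True
      then obtain n where n: "x \<in> support (s n)" by (auto simp: S_def)
      then have "openin Y (last (history (s n) x))"
        using valid[of n] by (intro E_moves_legal_last(1)) (auto simp: valid_def)
      then show ?thesis using fS[OF n] openin_subset by auto
    qed (use that pt in \<open>simp add: f_def\<close>)
    show "f x = pt" if "x \<in> nonisolated_points X" for x
      using that SD by (auto simp: f_def nonisolated_points_def)
    fix W assume W: "openin Y W" "pt \<in> W"
    then obtain m where m: "V m \<subseteq> W" using baseV by auto
    \<comment> \<open>This set contains all points where \<open>f\<close> leaves \<open>W\<close>: a
      point entering after stage \<open>m\<close> outside \<open>A\<close> enters in the controlled
      region.\<close>
    have "closedin X (A \<union> support (s m))"
      using A(1) valid[of m]
      by (intro closedin_Un closedin_finite_isolated_points[of "support (s m)"])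
        (auto simp: valid_def)
    moreover have "A \<union> support (s m) \<subseteq> isolated_points X"
      using A(2) valid[of m] by (simp add: valid_def)
    moreover have "{x \<in> topspace X. f x \<notin> W} \<subseteq> A \<union> support (s m)"
    proof
      fix x assume x: "x \<in> {x \<in> topspace X. f x \<notin> W}"
      show "x \<in> A \<union> support (s m)"
      proof (rule ccontr)
        assume out: "x \<notin> A \<union> support (s m)"
        have "x \<in> S" using x W(2) by (auto simp: f_def split: if_splits)
        moreover have "x \<notin> support (s m)" using out by simp
        ultimately obtain j where j: "m \<le> j" "x \<in> support (s (Suc j)) - support (s j)"
          using entry by blast
        moreover have "x \<notin> A" using out by simp
        ultimately have "x \<in> core (s j) \<union> C j" using A(3)[of j] by blast
        then have "f x \<in> V (level (s m))" using small j by simp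
        then show False using x m V_antimono[OF level_ge[of m]] by auto
      qed
    qed
    ultimately show "closedin X {x \<in> topspace X. f x \<notin> W}"
      by (rule closedin_subset_isolated_points)
  qed
  have "f \<in> box (s n)" for n
    unfolding box_def
  proof (intro CollectI conjI ballI)
    fix x assume x: "x \<in> core (s n) - support (s n)"
    show "f x \<in> V (level (s n))"
    proof (cases "x \<in> S")
      case True
      then obtain j where j: "n \<le> j" "x \<in> support (s (Suc j)) - support (s j)"
        using entry x by blast
      moreover have "x \<in> core (s j) \<union> C j" using x core_mono[OF j(1)] by auto
      ultimately show ?thesis using small by simp
    next
      case False
      \<comment> \<open>A carrier point that never enters the support has value \<open>pt\<close>,
        not \<open>undefined\<close>.\<close>
      have "x \<in> topspace X"
        using x valid[of n] compactin_subset_topspace[of X "core (s n)"] by (auto simp: valid_def)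
      then show ?thesis using False ptV by (simp add: f_def)
    qed
  qed (use fT fS in auto)
  then show ?thesis by (intro exI[of _ f]) simp
qed

section \<open>From DMOP to the Baire property\<close>

lemma DMOP_imp_Baire_space_Ck':
  assumes "DMOP X"
  shows "Baire_space (Ck' X Y pt)"
  unfolding Baire_space_def
proof (intro allI impI, elim conjE)
  let ?Z = "Ck' X Y pt"
  fix \<G> assume \<G>: "countable \<G>" "\<forall>G\<in>\<G>. openin ?Z G \<and> dense_in ?Z G"
  \<comment> \<open>Adding the whole space allows an enumeration even of an empty
    \<open>\<G>\<close>.\<close>
  define G where "G = from_nat_into (insert (topspace ?Z) \<G>)"
  have G: "range G = insert (topspace ?Z) \<G>"
    unfolding G_def using \<G>(1) by (intro range_from_nat_into) auto
  have dense_top: "dense_in ?Z (topspace ?Z)"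
    by (simp add: dense_in_def del: topspace_Ck')
  have GZ: "openin ?Z (G n)" "dense_in ?Z (G n)" for n
  proof -
    have "G n \<in> insert (topspace ?Z) \<G>" unfolding G[symmetric] by simp
    then have "openin ?Z (G n) \<and> dense_in ?Z (G n)"
    proof
      assume "G n = topspace ?Z"
      then show ?thesis using dense_top openin_topspace[of ?Z] by (simp only:)
    qed (use \<G>(2) in simp)
    then show "openin ?Z (G n)" "dense_in ?Z (G n)" by simp_all
  qed
  show "dense_in ?Z (topspace ?Z \<inter> \<Inter>\<G>)"
  proof (rule dense_inI)
    fix T assume T: "openin ?Z T" "T \<noteq> {}"
    \<comment> \<open>The unconstrained position; its first refinement serves to enter
      \<open>T\<close>.\<close>
    define e :: "('a, 'b) position" where "e = Position 0 {} {} (\<lambda>_. []) 0"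
    have e: "valid e" by (simp add: valid_def e_def E_moves_legal_def)
    have "reply_box e {} = topspace ?Z" by (simp add: reply_box_def e_def)
    then have "T \<inter> reply_box e {} \<noteq> {}" using T openin_subset[OF T(1)] by auto
    then obtain s0 where s0: "refines e {} s0" "box s0 \<subseteq> T"
      using refines_exists[OF e compactin_empty T(1)] by auto
    \<comment> \<open>\<open>s0\<close> has stage 1, hence the shift.\<close>
    define step where "step s C = (SOME t. refines s C t \<and> box t \<subseteq> G (stage s - 1))" for s C
    have step: "refines s C (step s C) \<and> box (step s C) \<subseteq> G (stage s - 1)"
      if s: "valid s" and C: "compactin X C" for s C
    proof -
      have "G (stage s - 1) \<inter> reply_box s C \<noteq> {}"
        using GZ(2) openin_reply_box[OF s C] reply_box_nonempty[OF s C] by (rule dense_in_meets_open)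
      then have "\<exists>t. refines s C t \<and> box t \<subseteq> G (stage s - 1)"
        by (rule refines_exists[OF s C GZ(1)])
      then show ?thesis unfolding step_def by (rule someI_ex)
    qed
    \<comment> \<open>The new points not confined by \<open>refines\<close>; they avoid
      \<open>C\<close>, as \<open>DMOP_game\<close> demands.\<close>
    define L where "L s C = support (step s C) - (support s \<union> core s \<union> C)" for s C
    obtain s K A where s: "s 0 = s0" "\<And>n. s (Suc n) = step (s n) (K n)"
        "\<And>n. valid (s n)" "\<And>n. compactin X (K n)"
        "closedin X A" "A \<subseteq> isolated_points X" "\<And>n. L (s n) (K n) \<subseteq> A"
    proof (rule DMOP_game[of X valid s0 step L])
      show "valid s0" using s0(1) by (simp add: refines_def)
      show "valid (step s C)" if "valid s" "compactin X C" for s C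
        using step[OF that] by (simp add: refines_def)
      show "finite (L s C) \<and> L s C \<subseteq> isolated_points X \<and> L s C \<inter> C = {}"
        if "valid s" "compactin X C" for s C
        using step[OF that] by (auto simp: refines_def valid_def L_def)
    qed (use assms in auto)
    have ref: "refines (s n) (K n) (s (Suc n))" "box (s (Suc n)) \<subseteq> G (stage (s n) - 1)" for n
      using step[OF s(3,4)] s(2) by simp_all
    have stage: "stage (s n) = Suc n" for n
    proof (induction n)
      case 0
      show ?case using s0(1) s(1) by (simp add: refines_def e_def)
    next
      case (Suc n)
      then show ?case using ref(1)[of n] by (simp add: refines_def)
    qed
    have "support (s (Suc n)) - (support (s n) \<union> core (s n) \<union> K n) \<subseteq> A" for n
      using s(7)[of n] s(2)[of n] by (simp add: L_def)
    then obtain f where f: "\<And>n. f \<in> box (s n)"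
      using refines_limit[of s K A, OF ref(1) s(3) s(5) s(6)] by auto
    have "f \<in> T" using f[of 0] s(1) s0(2) by auto
    moreover have "f \<in> B" if B: "B \<in> \<G>" for B
    proof -
      have "B \<in> range G" using B G by simp
      then obtain n where "B = G n" by auto
      \<comment> \<open>Since \<open>s n\<close> has stage \<open>Suc n\<close>,
        \<open>box (s (Suc n))\<close> lies in \<open>G n\<close>.\<close>
      then show ?thesis using f[of "Suc n"] ref(2)[of n] stage[of n] by auto
    qed
    moreover have "f \<in> topspace ?Z" using f[of 0] unfolding box_def by blast
    ultimately show "topspace ?Z \<inter> \<Inter>\<G> \<inter> T \<noteq> {}" by auto
  qed blast
qed

end

section \<open>A decreasing base at the base point, and the equivalence\<close>

lemma first_countable_at_decreasing_base:
  assumes "first_countable_at Y y" "y \<in> topspace Y"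
  shows "\<exists>V :: nat \<Rightarrow> 'b set. (\<forall>n. openin Y (V n) \<and> y \<in> V n \<and> V (Suc n) \<subseteq> V n) \<and>
    (\<forall>U. openin Y U \<longrightarrow> y \<in> U \<longrightarrow> (\<exists>n. V n \<subseteq> U))"
proof -
  obtain \<B> where B: "countable \<B>" "\<forall>V\<in>\<B>. openin Y V"
    "\<forall>U. openin Y U \<and> y \<in> U \<longrightarrow> (\<exists>V\<in>\<B>. y \<in> V \<and> V \<subseteq> U)"
    using assms(1) unfolding first_countable_at_def by (elim exE conjE)
  \<comment> \<open>Members of \<open>\<B>\<close> may miss \<open>y\<close>; these are discarded
    before intersecting.\<close>
  define \<C> where "\<C> = {V \<in> \<B>. y \<in> V}"
  have "\<C> \<noteq> {}" using B(3)[rule_format, of "topspace Y"] assms(2) by (auto simp: \<C>_def)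
  moreover have "countable \<C>" using B(1) by (simp add: \<C>_def)
  ultimately have range: "range (from_nat_into \<C>) = \<C>" by (rule range_from_nat_into)
  define b where "b = from_nat_into \<C>"
  have b: "openin Y (b n) \<and> y \<in> b n" for n
  proof -
    have "b n \<in> \<C>" using range unfolding b_def by blast
    then show ?thesis using B(2) by (simp add: \<C>_def)
  qed
  define V where "V n = (\<Inter>i\<le>n. b i)" for n
  have "openin Y (V n) \<and> y \<in> V n \<and> V (Suc n) \<subseteq> V n" for n
    using b by (auto simp: V_def intro!: openin_Inter)
  moreover have "\<exists>n. V n \<subseteq> U" if U: "openin Y U" "y \<in> U" for U
  proof -
    obtain W where W: "W \<in> \<C>" "W \<subseteq> U" using B(3) U unfolding \<C>_def by blast
    then obtain n where "W = b n" using range unfolding b_def by (metis imageE)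
    then have "V n \<subseteq> U" using W(2) by (auto simp: V_def)
    then show ?thesis by (intro exI)
  qed
  ultimately show ?thesis by (intro exI[of _ V]) simp
qed

theorem theorem4p4:
  fixes X :: "'a topology" and Y :: "'b topology" and pt :: 'b
  assumes "pt \<in> topspace Y"
    and "admissible_at Y pt"
    and "first_countable_at Y pt"
    and "Choquet_space Y"
  shows "(Baire_space (Ck' X Y pt) \<longleftrightarrow> \<not> meager_space (Ck' X Y pt)) \<and>
         (\<not> meager_space (Ck' X Y pt) \<longleftrightarrow> DMOP X)"
proof -
  obtain \<sigma> where \<sigma>: "winning_strategy_N Y \<sigma>"
    using assms(4) unfolding Choquet_space_def by (elim exE)
  obtain V :: "nat \<Rightarrow> 'b set" where V: "\<forall>n. openin Y (V n) \<and> pt \<in> V n \<and> V (Suc n) \<subseteq> V n"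
    "\<forall>U. openin Y U \<longrightarrow> pt \<in> U \<longrightarrow> (\<exists>n. V n \<subseteq> U)"
    using first_countable_at_decreasing_base[OF assms(3,1)] by (elim exE conjE)
  interpret function_space_game X Y pt \<sigma> V
    by unfold_locales (use assms(1) \<sigma> V in simp_all)
  have "Baire_space (Ck' X Y pt) \<Longrightarrow> \<not> meager_space (Ck' X Y pt)"
    using Ck'_topspace_nonempty[OF assms(1)] by (rule Baire_space_imp_not_meager_space[rotated])
  moreover have "\<not> meager_space (Ck' X Y pt) \<Longrightarrow> DMOP X"
    by (rule not_meager_Ck'_imp_DMOP[OF assms(1,2)])
  ultimately show ?thesis
    using DMOP_imp_Baire_space_Ck' by argo
qed

end
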